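(* Consider the F-RAN system described in the context, with any fronthaul rate $r\ge 0$ and fractional cache size $\mu\in[0,1]$. Then the minimum NDT (serial fronthaul-edge transmission) satisfies $$\delta^*(\mu,r)\le \delta_{ach}(\mu,r)=\text{l.c.e.}\big(\delta_F(\mu,r)+\delta_E(\mu,r)\big),$$ where l.c.e. is the lower convex envelope with respect to $\mu\in[0,1]$ for fixed $r$, $$\delta_F(\mu,r)=\frac{K_R\,(m(\mu,r)-\lfloor\mu K_T\rfloor)^+}{K_T r},\qquad \delta_E(\mu,r)=\frac{K_R}{\min\{m(\mu,r)\,n_T,K_R\}},$$ and $$m(\mu,r)=\begin{cases} m(r), & \mu K_T<m(r),\\ \lfloor \mu K_T\rfloor, & m(r)\le\mu K_T\le m_{max},\\ m_{max}, & \mu K_T>m_{max}.\end{cases}$$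
   Context: F-RAN model. $K_T,K_R,n_T\ge 1$ and $N\ge K_R$ are integers; $[K]=\{1,\dots,K\}$. There are $K_T$ edge nodes (ENs) with $n_T$ antennas each, $K_R$ single-antenna users, and a cloud with a library of $N$ files $W_1,\dots,W_N$ of equal size. Each file is split into $F\ge 1$ equal packets, $\mathcal W_n=\{W_{n1},\dots,W_{nF}\}$ ($F$ is a free design parameter). $\mu\in[0,1]$ is the fractional cache size and $r\ge 0$ the fronthaul rate (each fronthaul link has capacity $r\log P$ bits per channel use, $P$ = SNR). Caching: EN $i$ stores sets $\mathcal C_{in}\subseteq\mathcal W_n$ with $|\mathcal C_{in}|\le \mu F$ for every $n$, chosen before the requests are known; $\mathcal C_i=\bigcup_n\mathcal C_{in}$. Delivery: user $k$ requests file $d_k\in[N]$; $\boldsymbol d=(d_1,\dots,d_{K_R})$. The cloud sends to EN $i$ a set $\mathcal F_i$ of (uncoded) packets of requested files. Then edge transmission takes place in $B$ blocks by one-shot linear precoding: in each block $b$ a set $\mathcal R(b)\subseteq[K_R]$ of users is served, each $k\in\mathcal R(b)$ with exactly one packet of $W_{d_k}$; the stream for user $k$ is sent with precoding vectors $\boldsymbol v_{i,k}\in\mathbb C^{n_T}$ by those ENs $i$ whose set $\mathcal C_i\cup\mathcal F_i$ contains that packet (the other ENs use $\boldsymbol v_{i,k}=0$); decodability without interference means $\sum_i \boldsymbol h_{ki}^T\boldsymbol v_{i,k}\ne 0$ and $\sum_i \boldsymbol h_{k'i}^T\boldsymbol v_{i,k}=0$ for all $k'\in\mathcal R(b)\setminus\{k\}$,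 where $\boldsymbol h_{ki}=\boldsymbol h_{ki}(b)\in\mathbb C^{n_T}$ is the channel from EN $i$ to user $k$. After the $B$ blocks every user must have received all $F$ packets of its file. The fronthaul sets and the edge transmission may depend on $\boldsymbol d$ and on the channels. The channels are arbitrary but non-degenerate: in each block, every square submatrix of the $K_R\times K_Tn_T$ matrix with rows $(\boldsymbol h_{k1}^T,\dots,\boldsymbol h_{kK_T}^T)$ is invertible. NDT (serial mode): for a policy and request $\boldsymbol d$, the fronthaul NDT is $\max_i|\mathcal F_i|/(Fr)$ (if $r=0$, nothing may be sent on the fronthaul and this is $0$), the edge NDT is $B/F$, and the NDT of the policy is the maximum over $\boldsymbol d$ of their sum. $\bar\delta(\mu,r)$ is the infimum of the NDT over all $F\ge1$ and all policies ($+\infty$ if there is none), and the minimum NDT $\delta^*(\mu,r)$ is the lower convex envelope of $\bar\delta(\mu,r)$ as a function of $\mu\in[0,1]$ for fixed $r$. Further notation: $(x)^+=\max\{x,0\}$; $m_{max}=\min\{K_T,\lceil K_R/n_T\rceil\}$; $r_{th}=\frac{n_T}{K_T}m_{max}^2$; $m(r)=[\sqrt{K_Tr/n_T}]$ if $r<r_{th}$ and $m(r)=m_{max}$ if $r\ge r_{th}$, where $[x]$ is the nearest positive integer to $x$ (ties broken by any fixed rule). For $r=0$, a quotient with denominator $K_Tr$ is $+\infty$ if its numerator is positive and $0$ if its numerator is $0$. *)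

theory Defs
  imports
    "HOL-Library.Extended_Nonnegative_Real"
    "HOL-Library.FuncSet"
    "Jordan_Normal_Form.Matrix"
    "Jordan_Normal_Form.DL_Submatrix"
begin

section \<open>Lower convex envelope\<close>

text \<open>
  Delivery times are extended nonnegative reals, with value \<open>\<infinity>\<close> where no policy exists.
  The lower convex envelope is the largest convex minorant. The minorants are themselves
  allowed to take the value \<open>\<infinity>\<close>, and restricting them to nonnegative ones changes nothing
  because the enveloped function is nonnegative. In \<^typ>\<open>ennreal\<close> one has \<open>0 * \<infinity> = 0\<close>, so the
  inequality below is trivial for \<open>t = 0\<close> and \<open>t = 1\<close>.
\<close>

definition ext_convex_on :: "real set \<Rightarrow> (real \<Rightarrow> ennreal) \<Rightarrow> bool" where
  "ext_convex_on S g \<longleftrightarrow>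
     (\<forall>x\<in>S. \<forall>y\<in>S. \<forall>t\<in>{0..1}.
        g ((1 - t) * x + t * y) \<le> ennreal (1 - t) * g x + ennreal t * g y)"

definition lower_convex_envelope :: "real set \<Rightarrow> (real \<Rightarrow> ennreal) \<Rightarrow> real \<Rightarrow> ennreal" where
  "lower_convex_envelope S f x =
     (SUP g \<in> {g. ext_convex_on S g \<and> (\<forall>y\<in>S. g y \<le> f y)}. g x)"

section \<open>The F-RAN model\<close>

text \<open>
  Edge nodes, users, files, the packets of a file, antennas and transmission blocks are numbered
  from 0. The packet with index \<open>f\<close> of file \<open>n\<close> is the pair \<open>(n, f)\<close>.
\<close>

type_synonym packet = "nat \<times> nat"

definition file_packets :: "nat \<Rightarrow> nat \<Rightarrow> packet set" where
  "file_packets F n = {n} \<times> {..<F}"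

text \<open>\<open>h b k i\<close> is the channel vector from edge node \<open>i\<close> to user \<open>k\<close> in block \<open>b\<close>.\<close>

type_synonym channel = "nat \<Rightarrow> nat \<Rightarrow> nat \<Rightarrow> complex vec"

definition channel_matrix ::
    "nat \<Rightarrow> nat \<Rightarrow> nat \<Rightarrow> (nat \<Rightarrow> nat \<Rightarrow> complex vec) \<Rightarrow> complex mat" where
  "channel_matrix K_T K_R n_T hb =
     mat K_R (K_T * n_T) (\<lambda>(k, j). hb k (j div n_T) $ (j mod n_T))"

text \<open>
  A channel realization is an infinite sequence of blocks, since the number of blocks used is not
  bounded in advance.
\<close>

definition channels :: "nat \<Rightarrow> nat \<Rightarrow> nat \<Rightarrow> channel set" where
  "channels K_T K_R n_T =
     {h. \<forall>b. (\<forall>k<K_R. \<forall>i<K_T. h b k i \<in> carrier_vec n_T) \<and>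
             (\<forall>I J. I \<subseteq> {..<K_R} \<and> J \<subseteq> {..<K_T * n_T} \<and> card I = card J \<longrightarrow>
                invertible_mat (submatrix (channel_matrix K_T K_R n_T (h b)) I J))}"

definition requests :: "nat \<Rightarrow> nat \<Rightarrow> (nat \<Rightarrow> nat) set" where
  "requests K_R N = {..<K_R} \<rightarrow> {..<N}"

text \<open>\<open>C i n\<close> is the set of packets of file \<open>n\<close> cached at edge node \<open>i\<close>.\<close>

type_synonym caching = "nat \<Rightarrow> nat \<Rightarrow> packet set"

definition valid_caching :: "nat \<Rightarrow> nat \<Rightarrow> real \<Rightarrow> nat \<Rightarrow> caching \<Rightarrow> bool" where
  "valid_caching K_T N \<mu> F C \<longleftrightarrow>
     (\<forall>i<K_T. \<forall>n<N. C i n \<subseteq> file_packets F n \<and> real (card (C i n)) \<le> \<mu> * real F)"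

text \<open>
  In block \<open>b\<close>, user \<open>k \<in> served D b\<close> is sent the packet \<open>(d k, sent_index D b k)\<close>, and
  \<open>precoder D b i k\<close> is the precoding vector of edge node \<open>i\<close> for that stream.
\<close>

record delivery =
  fronthaul :: "nat \<Rightarrow> packet set"
  num_blocks :: nat
  served :: "nat \<Rightarrow> nat set"
  sent_index :: "nat \<Rightarrow> nat \<Rightarrow> nat"
  precoder :: "nat \<Rightarrow> nat \<Rightarrow> nat \<Rightarrow> complex vec"

text \<open>The product \<open>\<bullet>\<close> of complex vectors is the bilinear one, without conjugation.\<close>

definition valid_delivery ::
    "nat \<Rightarrow> nat \<Rightarrow> nat \<Rightarrow> nat \<Rightarrow> real \<Rightarrow> nat \<Rightarrow> caching \<Rightarrow> (nat \<Rightarrow> nat) \<Rightarrow> channel \<Rightarrow> delivery \<Rightarrow> bool"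
  where
  "valid_delivery K_T K_R n_T N r F C d h D \<longleftrightarrow>
     (\<forall>i<K_T. fronthaul D i \<subseteq> (\<Union>k<K_R. file_packets F (d k))) \<and>
     (r = 0 \<longrightarrow> (\<forall>i<K_T. fronthaul D i = {})) \<and>
     (\<forall>b<num_blocks D.
        served D b \<subseteq> {..<K_R} \<and>
        (\<forall>k\<in>served D b.
           sent_index D b k < F \<and>
           (\<forall>i<K_T.
              precoder D b i k \<in> carrier_vec n_T \<and>
              ((d k, sent_index D b k) \<notin> (\<Union>n<N. C i n) \<union> fronthaul D i \<longrightarrow>
                 precoder D b i k = 0\<^sub>v n_T)) \<and>
           (\<Sum>i<K_T. h b k i \<bullet> precoder D b i k) \<noteq> 0 \<and>
           (\<forall>k'\<in>served D b - {k}. (\<Sum>i<K_T. h b k' i \<bullet> precoder D b i k) = 0))) \<and>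
     (\<forall>k<K_R. \<forall>f<F. \<exists>b<num_blocks D. k \<in> served D b \<and> sent_index D b k = f)"

text \<open>
  The placement \<open>C\<close> depends neither on the requests nor on the channels, whereas the delivery is
  chosen as a function of both.
\<close>

type_synonym delivery_rule = "(nat \<Rightarrow> nat) \<Rightarrow> channel \<Rightarrow> delivery"

definition valid_policy ::
    "nat \<Rightarrow> nat \<Rightarrow> nat \<Rightarrow> nat \<Rightarrow> real \<Rightarrow> real \<Rightarrow> nat \<Rightarrow> caching \<Rightarrow> delivery_rule \<Rightarrow> bool" where
  "valid_policy K_T K_R n_T N \<mu> r F C \<pi> \<longleftrightarrow>
     F \<ge> 1 \<and> valid_caching K_T N \<mu> F C \<and>
     (\<forall>d\<in>requests K_R N. \<forall>h\<in>channels K_T K_R n_T.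
        valid_delivery K_T K_R n_T N r F C d h (\<pi> d h))"

section \<open>Normalized delivery time\<close>

definition fronthaul_ndt :: "nat \<Rightarrow> real \<Rightarrow> nat \<Rightarrow> delivery \<Rightarrow> real" where
  "fronthaul_ndt K_T r F D =
     (if r = 0 then 0
      else real (Max ((\<lambda>i. card (fronthaul D i)) ` {..<K_T})) / (real F * r))"

definition edge_ndt :: "nat \<Rightarrow> delivery \<Rightarrow> real" where
  "edge_ndt F D = real (num_blocks D) / real F"

text \<open>
  As the delivery may depend on the channels, the delivery time of a policy is the worst case over
  the channel realizations as well as over the requests.
\<close>

definition policy_ndt ::
    "nat \<Rightarrow> nat \<Rightarrow> nat \<Rightarrow> nat \<Rightarrow> real \<Rightarrow> nat \<Rightarrow> delivery_rule \<Rightarrow> ennreal" where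
  "policy_ndt K_T K_R n_T N r F \<pi> =
     (SUP d \<in> requests K_R N. SUP h \<in> channels K_T K_R n_T.
        ennreal (fronthaul_ndt K_T r F (\<pi> d h) + edge_ndt F (\<pi> d h)))"

definition delta_bar :: "nat \<Rightarrow> nat \<Rightarrow> nat \<Rightarrow> nat \<Rightarrow> real \<Rightarrow> real \<Rightarrow> ennreal" where
  "delta_bar K_T K_R n_T N \<mu> r =
     Inf {policy_ndt K_T K_R n_T N r F \<pi> |F C \<pi>. valid_policy K_T K_R n_T N \<mu> r F C \<pi>}"

definition delta_star :: "nat \<Rightarrow> nat \<Rightarrow> nat \<Rightarrow> nat \<Rightarrow> real \<Rightarrow> real \<Rightarrow> ennreal" where
  "delta_star K_T K_R n_T N \<mu> r =
     lower_convex_envelope {0..1} (\<lambda>\<mu>'. delta_bar K_T K_R n_T N \<mu>' r) \<mu>"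

section \<open>The achievable delivery time\<close>

definition nearest_pos_rule :: "(real \<Rightarrow> nat) \<Rightarrow> bool" where
  "nearest_pos_rule rnd \<longleftrightarrow>
     (\<forall>x\<ge>0. rnd x \<ge> 1 \<and> (\<forall>k\<ge>1. \<bar>x - real (rnd x)\<bar> \<le> \<bar>x - real k\<bar>))"

definition m_max :: "nat \<Rightarrow> nat \<Rightarrow> nat \<Rightarrow> nat" where
  "m_max K_T K_R n_T = min K_T (nat \<lceil>real K_R / real n_T\<rceil>)"

definition r_th :: "nat \<Rightarrow> nat \<Rightarrow> nat \<Rightarrow> real" where
  "r_th K_T K_R n_T = real n_T / real K_T * (real (m_max K_T K_R n_T))\<^sup>2"

definition m_rate :: "(real \<Rightarrow> nat) \<Rightarrow> nat \<Rightarrow> nat \<Rightarrow> nat \<Rightarrow> real \<Rightarrow> nat" where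
  "m_rate rnd K_T K_R n_T r =
     (if r < r_th K_T K_R n_T then rnd (sqrt (real K_T * r / real n_T)) else m_max K_T K_R n_T)"

definition m_mult :: "(real \<Rightarrow> nat) \<Rightarrow> nat \<Rightarrow> nat \<Rightarrow> nat \<Rightarrow> real \<Rightarrow> real \<Rightarrow> nat" where
  "m_mult rnd K_T K_R n_T \<mu> r =
     (if \<mu> * real K_T < real (m_rate rnd K_T K_R n_T r) then m_rate rnd K_T K_R n_T r
      else if \<mu> * real K_T \<le> real (m_max K_T K_R n_T) then nat \<lfloor>\<mu> * real K_T\<rfloor>
      else m_max K_T K_R n_T)"

text \<open>
  Division in \<^typ>\<open>ennreal\<close> satisfies \<open>0 / 0 = 0\<close> and \<open>x / 0 = \<infinity>\<close> for \<open>x > 0\<close>, which is the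
  convention intended for \<open>r = 0\<close>.
\<close>

definition delta_F :: "(real \<Rightarrow> nat) \<Rightarrow> nat \<Rightarrow> nat \<Rightarrow> nat \<Rightarrow> real \<Rightarrow> real \<Rightarrow> ennreal" where
  "delta_F rnd K_T K_R n_T \<mu> r =
     ennreal (real K_R *
       max (real (m_mult rnd K_T K_R n_T \<mu> r) - real_of_int \<lfloor>\<mu> * real K_T\<rfloor>) 0)
     / ennreal (real K_T * r)"

definition delta_E :: "(real \<Rightarrow> nat) \<Rightarrow> nat \<Rightarrow> nat \<Rightarrow> nat \<Rightarrow> real \<Rightarrow> real \<Rightarrow> ennreal" where
  "delta_E rnd K_T K_R n_T \<mu> r =
     ennreal (real K_R / real (min (m_mult rnd K_T K_R n_T \<mu> r * n_T) K_R))"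

definition delta_ach :: "(real \<Rightarrow> nat) \<Rightarrow> nat \<Rightarrow> nat \<Rightarrow> nat \<Rightarrow> real \<Rightarrow> real \<Rightarrow> ennreal" where
  "delta_ach rnd K_T K_R n_T \<mu> r =
     lower_convex_envelope {0..1}
       (\<lambda>\<mu>'. delta_F rnd K_T K_R n_T \<mu>' r + delta_E rnd K_T K_R n_T \<mu>' r) \<mu>"

end

theory Submission
  imports Defs
begin

text \<open>
  The bound already holds before taking envelopes. Put \<open>j = \<lfloor>\<mu> K_T\<rfloor>\<close>, let \<open>m\<close> be the multiplicity
  and \<open>u = min (m n_T) K_R\<close>, and split each file into \<open>F = K_T u\<close> packets. Packet \<open>f\<close> is cached at the
  \<open>j\<close> edge nodes \<open>i\<close> with \<open>(i + f) mod K_T < j\<close>, and the fronthaul brings it to those with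
  \<open>j \<le> (i + f) mod K_T < m\<close>, so that it is available at \<open>m\<close> edge nodes, which have \<open>m n_T \<ge> u\<close>
  antennas. The \<open>K_R F\<close> requested packets are sent \<open>u\<close> at a time in the round-robin order of the users;
  each stream uses as many antennas of its own cluster as there are users served in the block, and
  inverting the corresponding square submatrix of the channel cancels it at the other users.
\<close>

section \<open>Zero forcing\<close>

text \<open>\<open>submatrix\<close> renumbers the chosen rows and columns by their rank, and
  \<open>pick J\<close> undoes this numbering. The bijection turns sums over original column indices
  into sums over columns of the submatrix.\<close>

lemma rank_bij_betw:
  fixes J :: "nat set"
  assumes "finite J"
  shows "bij_betw (\<lambda>j. card {a\<in>J. a < j}) J {..<card J}"
proof -
  let ?r = "\<lambda>j. card {a\<in>J. a < j}"
  have inj: "inj_on ?r J"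
    by (rule inj_on_inverseI[where g = "pick J"]) (simp add: pick_card_in_set)
  have "?r ` J \<subseteq> {..<card J}"
    using assms by (auto intro!: psubset_card_mono)
  then have "?r ` J = {..<card J}"
    by (rule card_subset_eq[rotated]) (simp_all add: card_image[OF inj])
  with inj show ?thesis by (simp add: bij_betw_def)
qed

text \<open>The vector \<open>x\<close> is the column of the inverse submatrix that belongs to row
  \<open>k\<close>, extended by zero outside \<open>J\<close>. Multiplying it by the rows in
  \<open>I\<close> reproduces a column of the identity matrix.\<close>

lemma zero_forcing:
  fixes A :: "complex mat"
  assumes I: "I \<subseteq> {..<dim_row A}" and J: "J \<subseteq> {..<dim_col A}"
    and inv: "invertible_mat (submatrix A I J)" and k: "k \<in> I"
  obtains x where "\<And>j. j \<notin> J \<Longrightarrow> x j = 0"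
    and "\<And>l. l \<in> I \<Longrightarrow> (\<Sum>j<dim_col A. A $$ (l, j) * x j) = (if l = k then 1 else 0)"
proof -
  define S where "S = submatrix A I J"
  define rI where "rI = (\<lambda>i. card {a\<in>I. a < i})"
  define rJ where "rJ = (\<lambda>j. card {a\<in>J. a < j})"
  have finI: "finite I" and finJ: "finite J"
    using I J finite_subset by auto
  have bI: "bij_betw rI I {..<card I}" and bJ: "bij_betw rJ J {..<card J}"
    unfolding rI_def rJ_def using rank_bij_betw finI finJ by auto
  have "{i. i < dim_row A \<and> i \<in> I} = I" "{j. j < dim_col A \<and> j \<in> J} = J"
    using I J by auto
  then have dS: "dim_row S = card I" "dim_col S = card J"
    by (simp_all add: S_def dim_submatrix)
  from inv have sq: "card I = card J" and "\<exists>B. inverts_mat S B \<and> inverts_mat B S"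
    using dS unfolding invertible_mat_def S_def[symmetric] by auto
  then obtain B where B: "S * B = 1\<^sub>m (card I)" "B * S = 1\<^sub>m (dim_row B)"
    using dS by (auto simp: inverts_mat_def)
  \<comment> \<open>Invertibility does not state the shape of \<open>B\<close>; it is read off by
    comparing dimensions in the two product equations.\<close>
  have dB: "dim_col B = card I" "dim_row B = card J"
    using arg_cong[OF B(1), of dim_col] arg_cong[OF B(2), of dim_col] dS by auto
  define x where "x = (\<lambda>j. if j \<in> J then B $$ (rJ j, rI k) else 0)"
  have rk: "rI l < card I" if "l \<in> I" for l
    using bI that by (auto simp: bij_betw_def)
  have "(\<Sum>j<dim_col A. A $$ (l, j) * x j) = (if l = k then 1 else 0)" if l: "l \<in> I" for l
  proof -
    have "(\<Sum>j<dim_col A. A $$ (l, j) * x j) = (\<Sum>j\<in>J. A $$ (l, j) * x j)"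
      by (rule sum.mono_neutral_right) (use J in \<open>auto simp: x_def\<close>)
    also have "\<dots> = (\<Sum>j\<in>J. S $$ (rI l, rJ j) * B $$ (rJ j, rI k))"
    proof (rule sum.cong[OF refl])
      fix j assume j: "j \<in> J"
      have "S $$ (rI l, rJ j) = A $$ (l, j)"
        unfolding S_def rI_def rJ_def
        by (rule submatrix_index_card) (use I J l j in auto)
      with j show "A $$ (l, j) * x j = S $$ (rI l, rJ j) * B $$ (rJ j, rI k)"
        by (simp add: x_def)
    qed
    also have "\<dots> = (\<Sum>q<card J. S $$ (rI l, q) * B $$ (q, rI k))"
      by (rule sum.reindex_bij_betw[OF bJ])
    also have "\<dots> = (S * B) $$ (rI l, rI k)"
      using rk[OF l] rk[OF k] dS dB by (simp add: scalar_prod_def lessThan_atLeast0)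
    also have "\<dots> = (if rI l = rI k then 1 else 0)"
      using rk[OF l] rk[OF k] B by simp
    also have "rI l = rI k \<longleftrightarrow> l = k"
      using bI l k by (auto simp: bij_betw_def inj_on_def)
    finally show ?thesis .
  qed
  then show ?thesis
    by (intro that[of x]) (auto simp: x_def)
qed

text \<open>Column \<open>j\<close> of the channel matrix is antenna \<open>j mod n\<close> of edge
  node \<open>j div n\<close>, so this counts the columns available to the cluster
  \<open>M\<close>.\<close>

lemma card_antennas:
  assumes "n \<ge> 1" and "M \<subseteq> {..<K::nat}"
  shows "card {j. j < K * n \<and> j div n \<in> M} = card M * n"
proof -
  have "bij_betw (\<lambda>(i, a). i * n + a) (M \<times> {..<n}) {j. j < K * n \<and> j div n \<in> M}"
  proof (rule bij_betw_byWitness[where f' = "\<lambda>j. (j div n, j mod n)"])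
    show "(\<lambda>(i, a). i * n + a) ` (M \<times> {..<n}) \<subseteq> {j. j < K * n \<and> j div n \<in> M}"
    proof clarsimp
      fix i a assume "i \<in> M" "a < n"
      then have "Suc i \<le> K" using assms by auto
      then have "Suc i * n \<le> K * n" by (rule mult_right_mono) simp
      with \<open>a < n\<close> show "i * n + a < K * n" by simp
    qed
  qed (use assms in \<open>auto\<close>)
  from bij_betw_same_card[OF this] show ?thesis
    by (simp add: card_cartesian_product)
qed

text \<open>By \<open>le\<close> the cluster owns at least as many columns as there are served
  users. Any \<open>card R\<close> of them form with the rows in \<open>R\<close> a square
  submatrix, invertible by non-degeneracy, and its zero-forcing vector is cut into one piece of
  length \<open>n_T\<close> per edge node.\<close>

lemma zero_forcing_precoder:
  assumes h: "h \<in> channels K_T K_R n_T" and n: "n_T \<ge> 1"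
    and M: "M \<subseteq> {..<K_T}" and R: "R \<subseteq> {..<K_R}" and k: "k \<in> R"
    and le: "card R \<le> card M * n_T"
  obtains v where "\<And>i. v i \<in> carrier_vec n_T"
    and "\<And>i. i < K_T \<Longrightarrow> i \<notin> M \<Longrightarrow> v i = 0\<^sub>v n_T"
    and "\<And>l. l \<in> R \<Longrightarrow> (\<Sum>i<K_T. h b l i \<bullet> v i) = (if l = k then 1 else 0)"
proof -
  define A where "A = channel_matrix K_T K_R n_T (h b)"
  have dA: "dim_row A = K_R" "dim_col A = K_T * n_T"
    by (simp_all add: A_def channel_matrix_def)
  obtain J where J: "J \<subseteq> {j. j < K_T * n_T \<and> j div n_T \<in> M}" "card J = card R"
    using obtain_subset_with_card_n[of "card R" "{j. j < K_T * n_T \<and> j div n_T \<in> M}"]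
      card_antennas[OF n M] le by metis
  have J': "J \<subseteq> {..<K_T * n_T}" using J by auto
  have "invertible_mat (submatrix A R J)"
    using h R J' J(2) unfolding channels_def A_def by simp
  with zero_forcing[of R A J k] R J' k dA obtain x where
    x0: "\<And>j. j \<notin> J \<Longrightarrow> x j = 0" and
    x1: "\<And>l. l \<in> R \<Longrightarrow> (\<Sum>j<K_T * n_T. A $$ (l, j) * x j) = (if l = k then 1 else 0)"
    by auto
  define v where "v = (\<lambda>i. vec n_T (\<lambda>a. x (i * n_T + a)))"
  show ?thesis
  proof (rule that[of v])
    show "v i \<in> carrier_vec n_T" for i by (simp add: v_def)
    show "v i = 0\<^sub>v n_T" if "i < K_T" "i \<notin> M" for i
    proof (rule eq_vecI)
      fix a assume "a < dim_vec (0\<^sub>v n_T :: complex vec)"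
      then have a: "a < n_T" by simp
      then have "(i * n_T + a) div n_T = i" by simp
      then have "i * n_T + a \<notin> J" using J(1) that by auto
      with a show "v i $ a = 0\<^sub>v n_T $ a" by (simp add: v_def x0)
    qed (simp add: v_def)
    fix l assume l: "l \<in> R"
    have "h b l i \<bullet> v i = (\<Sum>j\<in>{i * n_T..<i * n_T + n_T}. A $$ (l, j) * x j)"
      if i: "i < K_T" for i
    proof -
      have "h b l i \<bullet> v i = (\<Sum>a<n_T. h b l i $ a * x (i * n_T + a))"
        by (simp add: scalar_prod_def v_def lessThan_atLeast0)
      also have "\<dots> = (\<Sum>a<n_T. A $$ (l, i * n_T + a) * x (i * n_T + a))"
      proof (rule sum.cong[OF refl])
        fix a assume "a \<in> {..<n_T}"
        then have a: "a < n_T" by simp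
        have "Suc i * n_T \<le> K_T * n_T" using i by (intro mult_right_mono) auto
        with a have "i * n_T + a < K_T * n_T" by simp
        moreover have "l < K_R" using l R by auto
        ultimately have "A $$ (l, i * n_T + a) = h b l i $ a"
          using a by (simp add: A_def channel_matrix_def)
        then show "h b l i $ a * x (i * n_T + a) = A $$ (l, i * n_T + a) * x (i * n_T + a)"
          by simp
      qed
      also have "\<dots> = (\<Sum>j\<in>{i * n_T..<i * n_T + n_T}. A $$ (l, j) * x j)"
        using sum.shift_bounds_nat_ivl[of "\<lambda>j. A $$ (l, j) * x j" 0 "i * n_T" n_T]
        by (simp add: lessThan_atLeast0 add.commute)
      finally show ?thesis .
    qed
    then have "(\<Sum>i<K_T. h b l i \<bullet> v i)
        = (\<Sum>i<K_T. \<Sum>j\<in>{i * n_T..<i * n_T + n_T}. A $$ (l, j) * x j)"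
      by simp
    also have "\<dots> = (\<Sum>j<K_T * n_T. A $$ (l, j) * x j)"
      by (rule sum.nat_group)
    finally show "(\<Sum>i<K_T. h b l i \<bullet> v i) = (if l = k then 1 else 0)"
      using x1[OF l] by simp
  qed
qed

section \<open>Cyclic placement and round-robin delivery\<close>

text \<open>Adding \<open>i\<close> modulo \<open>K\<close> permutes the residues, so every set of
  \<open>s\<close> residues has exactly \<open>s\<close> preimages in one period. As
  \<open>i\<close> and \<open>f\<close> enter symmetrically, this also counts the edge nodes that
  hold a given packet.\<close>

lemma card_residues_block:
  assumes "s \<le> K"
  shows "card {f. f < (K::nat) \<and> (i + f) mod K < s} = s"
proof (cases "K = 0")
  case False
  let ?g = "\<lambda>f. (i + f) mod K"
  have inj: "inj_on ?g {..<K}"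
  proof (rule inj_onI)
    fix a b assume "a \<in> {..<K}" "b \<in> {..<K}" and eq: "(i + a) mod K = (i + b) mod K"
    from eq obtain p q where "a + K * p = b + K * q"
      by (auto simp: nat_mod_eq_iff add.assoc)
    from arg_cong[OF this, of "\<lambda>x. x mod K"] \<open>a \<in> {..<K}\<close> \<open>b \<in> {..<K}\<close> show "a = b"
      by (simp only: mod_mult_self2 lessThan_iff mod_less)
  qed
  have surj: "?g ` {..<K} = {..<K}"
    by (rule endo_inj_surj) (use inj False in auto)
  have "?g ` {f. f < K \<and> ?g f < s} = ?g ` {..<K} \<inter> {..<s}" by blast
  also have "\<dots> = {..<s}"
    unfolding surj using assms by auto
  finally have "card (?g ` {f. f < K \<and> ?g f < s}) = s" by simp
  moreover have "inj_on ?g {f. f < K \<and> ?g f < s}"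
    by (rule inj_on_subset[OF inj]) auto
  ultimately show ?thesis by (simp only: card_image)
qed (use assms in simp)

lemma card_residues:
  assumes "s \<le> K"
  shows "card {f. f < (K::nat) * u \<and> (i + f) mod K < s} = s * u"
proof (induction u)
  case (Suc u)
  let ?B = "{f. f < K \<and> (i + f) mod K < s}"
  have shift: "(i + (g + K * u)) mod K = (i + g) mod K" for g
    using mod_mult_self2[of "i + g" K u] by (simp only: add.assoc)
  \<comment> \<open>The last of the \<open>Suc u\<close> periods is a translate of the first by a
    multiple of \<open>K\<close>, which preserves the residue condition.\<close>
  have split: "{f. f < K * Suc u \<and> (i + f) mod K < s}
      = {f. f < K * u \<and> (i + f) mod K < s} \<union> (\<lambda>f. f + K * u) ` ?B" (is "?L = ?R")
  proof
    show "?L \<subseteq> ?R"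
    proof
      fix f assume f: "f \<in> ?L"
      show "f \<in> ?R"
      proof (cases "f < K * u")
        case False
        then have "f = f - K * u + K * u" by simp
        then obtain g where g: "f = g + K * u" by blast
        with f have "g < K" "(i + g) mod K < s" by (simp_all add: shift)
        with g show ?thesis by blast
      qed (use f in auto)
    qed
    show "?R \<subseteq> ?L" by (auto simp: shift)
  qed
  have "card {f. f < K * Suc u \<and> (i + f) mod K < s}
      = card {f. f < K * u \<and> (i + f) mod K < s} + card ((\<lambda>f. f + K * u) ` ?B)"
    unfolding split
    by (rule card_Un_disjoint) auto
  also have "card ((\<lambda>f. f + K * u) ` ?B) = s"
    using card_residues_block[OF assms, of i] by (simp add: card_image)
  finally show ?case using Suc by simp
qed simp

text \<open>Consecutive packets of one user stand \<open>K\<close> places apart in the round-robin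
  order, so a window of length \<open>u \<le> K\<close> contains at most one of them. Hence a block
  never needs two packets for the same user.\<close>

lemma round_robin_window_unique:
  fixes f g k u K :: nat
  assumes "u \<le> K" "p \<le> f * K + k" "f * K + k < p + u" "p \<le> g * K + k" "g * K + k < p + u"
  shows "f = g"
proof -
  have *: "\<not> a < b" if "p \<le> a * K + k" "b * K + k < p + u" for a b
  proof
    assume "a < b"
    then have "Suc a * K \<le> b * K" by (intro mult_right_mono) auto
    then have "a * K + K \<le> b * K" by simp
    with that assms(1) show False by linarith
  qed
  from *[of f g] *[of g f] assms show ?thesis by force
qed

text \<open>\<open>C\<close> involves neither \<open>d\<close> nor \<open>h\<close>, so one
  placement serves all requests and channels; only \<open>D\<close> adapts to them. For
  \<open>r = 0\<close> the condition \<open>m \<le> j\<close> places the whole cluster of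
  \<open>m\<close> nodes among those caching the packet, and the fronthaul stays empty.\<close>

lemma ex_valid_delivery:
  fixes K_T K_R n_T N j m :: nat and r :: real
  defines "u \<equiv> min (m * n_T) K_R"
  defines "F \<equiv> K_T * u"
  defines "C \<equiv> (\<lambda>i n. {n} \<times> {f. f < F \<and> (i + f) mod K_T < j})"
  assumes K_T: "K_T \<ge> 1" and K_R: "K_R \<ge> 1" and n_T: "n_T \<ge> 1"
    and m: "1 \<le> m" "m \<le> K_T" and j: "j \<le> K_T" and r: "r \<ge> 0" "r = 0 \<Longrightarrow> m \<le> j"
    and d: "d \<in> requests K_R N" and h: "h \<in> channels K_T K_R n_T"
  shows "\<exists>D. valid_delivery K_T K_R n_T N r F C d h D \<and>
    fronthaul_ndt K_T r F D \<le> real K_R * real (m - j) / (real K_T * r) \<and>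
    edge_ndt F D = real K_R / real u"
proof -
  have u: "1 \<le> u" "u \<le> K_R" "u \<le> m * n_T"
    using m n_T K_R by (auto simp: u_def)
  have dN: "d k < N" if "k < K_R" for k
    using d that by (auto simp: requests_def)
  define Z where "Z = (\<lambda>i. {f. f < F \<and> j \<le> (i + f) mod K_T \<and> (i + f) mod K_T < m})"
  define \<Phi> where "\<Phi> = (\<lambda>i. \<Union>k<K_R. {d k} \<times> Z i)"
  \<comment> \<open>Packet \<open>f\<close> of user \<open>k\<close> has position
    \<open>f * K_R + k\<close> in the transmission order, and block \<open>b\<close> covers the
    \<open>u\<close> positions from \<open>b * u\<close> on.\<close>
  define slot where "slot = (\<lambda>b k f. b * u \<le> f * K_R + k \<and> f * K_R + k < b * u + u)"
  define S where "S = (\<lambda>b. {k. k < K_R \<and> (\<exists>f<F. slot b k f)})"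
  define idx where "idx = (\<lambda>b k. SOME f. f < F \<and> slot b k f)"
  define M where "M = (\<lambda>f. {i. i < K_T \<and> (i + f) mod K_T < m})"
  have idx: "idx b k < F" "slot b k (idx b k)" if "k \<in> S b" for b k
    using someI_ex[of "\<lambda>f. f < F \<and> slot b k f"] that unfolding S_def idx_def by auto
  have cardM: "card (M f) = m" for f
    using card_residues_block[OF m(2), of f] by (simp add: M_def add.commute)
  have cardS: "card (S b) \<le> u" for b
  proof -
    \<comment> \<open>A position determines its user as the remainder modulo \<open>K_R\<close>, so
      the \<open>u\<close> positions of a block involve at most \<open>u\<close> users.\<close>
    have "S b \<subseteq> (\<lambda>p. p mod K_R) ` {b * u..<b * u + u}"
    proof
      fix k assume "k \<in> S b"
      then obtain f where "k < K_R" "slot b k f" by (auto simp: S_def)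
      then show "k \<in> (\<lambda>p. p mod K_R) ` {b * u..<b * u + u}"
        by (intro image_eqI[of _ _ "f * K_R + k"]) (auto simp: slot_def)
    qed
    then have "card (S b) \<le> card ((\<lambda>p. p mod K_R) ` {b * u..<b * u + u})"
      by (intro card_mono) auto
    also have "\<dots> \<le> u" using card_image_le[of "{b * u..<b * u + u}" "\<lambda>p. p mod K_R"] by simp
    finally show ?thesis .
  qed
  have "\<forall>b k. \<exists>v. k \<in> S b \<longrightarrow> (\<forall>i. v i \<in> carrier_vec n_T) \<and>
      (\<forall>i. i < K_T \<longrightarrow> i \<notin> M (idx b k) \<longrightarrow> v i = 0\<^sub>v n_T) \<and>
      (\<forall>l\<in>S b. (\<Sum>i<K_T. h b l i \<bullet> v i) = (if l = k then 1 else 0))"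
    (is "\<forall>b k. \<exists>v. ?P b k v")
  proof (intro allI)
    fix b k
    show "\<exists>v. ?P b k v"
    proof (cases "k \<in> S b")
      case True
      have sub: "M (idx b k) \<subseteq> {..<K_T}" "S b \<subseteq> {..<K_R}" by (auto simp: M_def S_def)
      have "card (S b) \<le> card (M (idx b k)) * n_T"
        using cardS[of b] u(3) cardM by simp
      from zero_forcing_precoder[OF h n_T sub True this, of b] obtain v
        where "\<And>i. v i \<in> carrier_vec n_T"
          "\<And>i. i < K_T \<Longrightarrow> i \<notin> M (idx b k) \<Longrightarrow> v i = 0\<^sub>v n_T"
          "\<And>l. l \<in> S b \<Longrightarrow> (\<Sum>i<K_T. h b l i \<bullet> v i) = (if l = k then 1 else 0)"
        by blast
      then show ?thesis by (intro exI[of _ v]) simp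
    qed simp
  qed
  then obtain V where "\<forall>b k. ?P b k (V b k)"
    unfolding choice_iff by blast
  then have V_carrier: "V b k i \<in> carrier_vec n_T"
    and V_zero: "i < K_T \<Longrightarrow> i \<notin> M (idx b k) \<Longrightarrow> V b k i = 0\<^sub>v n_T"
    and V_gain: "l \<in> S b \<Longrightarrow> (\<Sum>i<K_T. h b l i \<bullet> V b k i) = (if l = k then 1 else 0)"
    if "k \<in> S b" for b k i l
    using that by blast+
  define D where "D = \<lparr>fronthaul = \<Phi>, num_blocks = K_R * K_T, served = S, sent_index = idx,
    precoder = \<lambda>b i k. V b k i\<rparr>"
  have available: "(d k, f) \<in> (\<Union>n<N. C i n) \<union> \<Phi> i" if "i \<in> M f" "k < K_R" "f < F" for i k f
  proof (cases "(i + f) mod K_T < j")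
    case True
    with that have "(d k, f) \<in> C i (d k)" by (simp add: C_def)
    with dN[OF that(2)] show ?thesis by blast
  next
    case False
    with that show ?thesis by (auto simp: Z_def \<Phi>_def M_def)
  qed
  have complete: "\<exists>b<K_R * K_T. k \<in> S b \<and> idx b k = f" if k: "k < K_R" and f: "f < F" for k f
  proof -
    let ?p = "f * K_R + k"
    let ?b = "?p div u"
    have slot: "slot ?b k f"
      unfolding slot_def
      using div_times_less_eq_dividend[of ?p u] dividend_less_div_times[of u ?p] u(1) by linarith
    then have S: "k \<in> S ?b" using k f by (auto simp: S_def)
    \<comment> \<open>There are \<open>F * K_R = K_R * K_T * u\<close> positions in all, which fill
      exactly \<open>K_R * K_T\<close> blocks of length \<open>u\<close>.\<close>
    have "Suc f * K_R \<le> F * K_R" using f by (intro mult_right_mono) auto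
    with k have "?p < F * K_R" by simp
    also have "\<dots> = K_R * K_T * u" by (simp add: F_def)
    finally have "?b < K_R * K_T" by (rule less_mult_imp_div_less)
    moreover have "idx ?b k = f"
      using idx[OF S] slot u(2) round_robin_window_unique[of u K_R "?b * u"]
      unfolding slot_def by blast
    ultimately show ?thesis using S by blast
  qed
  have "valid_delivery K_T K_R n_T N r F C d h D"
    unfolding valid_delivery_def
  proof (intro conjI allI impI ballI)
    fix i
    show "fronthaul D i \<subseteq> (\<Union>k<K_R. file_packets F (d k))"
      by (auto simp: D_def Z_def \<Phi>_def file_packets_def)
    show "fronthaul D i = {}" if "r = 0"
      using r(2)[OF that] by (auto simp: D_def Z_def \<Phi>_def)
  next
    fix b show "served D b \<subseteq> {..<K_R}" by (auto simp: D_def S_def)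
  next
    fix b k assume "k \<in> served D b"
    then have k: "k \<in> S b" by (simp add: D_def)
    then have kK: "k < K_R" by (simp add: S_def)
    show "sent_index D b k < F" using idx[OF k] by (simp add: D_def)
    show "(\<Sum>i<K_T. h b k i \<bullet> precoder D b i k) \<noteq> 0"
      using V_gain[OF k k] by (simp add: D_def)
    fix i
    show "precoder D b i k \<in> carrier_vec n_T" using V_carrier[OF k] by (simp add: D_def)
    assume "i < K_T" "(d k, sent_index D b k) \<notin> (\<Union>n<N. C i n) \<union> fronthaul D i"
    \<comment> \<open>Contrapositive of \<open>available\<close>: a node lacking the packet lies
      outside its cluster, where the precoder vanishes.\<close>
    then show "precoder D b i k = 0\<^sub>v n_T"
      using V_zero[OF k, of i] available[OF _ kK idx(1)[OF k], of i]
      unfolding D_def delivery.simps by blast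
  next
    fix b k k' assume "k \<in> served D b" "k' \<in> served D b - {k}"
    then show "(\<Sum>i<K_T. h b k' i \<bullet> precoder D b i k) = 0"
      using V_gain[of k b k'] by (simp add: D_def)
  next
    fix k f assume "k < K_R" "f < F"
    then show "\<exists>b<num_blocks D. k \<in> served D b \<and> sent_index D b k = f"
      using complete by (simp add: D_def)
  qed
  moreover have "edge_ndt F D = real K_R / real u"
    using K_T u by (simp add: edge_ndt_def D_def F_def field_simps)
  \<comment> \<open>At \<open>r = 0\<close> the left side is zero by definition and the right side
    because real division by zero gives zero.\<close>
  moreover have "fronthaul_ndt K_T r F D \<le> real K_R * real (m - j) / (real K_T * r)"
  proof (cases "r = 0")
    case False
    \<comment> \<open>Only an upper bound: users requesting the same file share their packets in the
      union.\<close>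
    have card: "card (\<Phi> i) \<le> K_R * ((m - j) * u)" for i
    proof -
      \<comment> \<open>The minimum keeps \<open>?Y\<close> inside \<open>?X\<close> when
        \<open>j\<close> exceeds \<open>m\<close>; then \<open>Z i\<close> is empty, in agreement
        with the truncated difference \<open>m - j\<close>.\<close>
      let ?X = "{f. f < F \<and> (i + f) mod K_T < m}"
        and ?Y = "{f. f < F \<and> (i + f) mod K_T < min j m}"
      have "Z i = ?X - ?Y"
        by (auto simp: Z_def)
      then have "card (Z i) = card (?X - ?Y)"
        by (rule arg_cong)
      also have "\<dots> = card ?X - card ?Y"
        by (rule card_Diff_subset) auto
      also have "\<dots> = m * u - min j m * u"
        using card_residues[OF m(2), of u i] card_residues[of "min j m" K_T u i] j
        by (simp add: F_def)
      also have "\<dots> = (m - j) * u" by (simp add: min_def diff_mult_distrib)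
      finally have *: "card (Z i) = (m - j) * u" .
      have "card (\<Phi> i) \<le> (\<Sum>k<K_R. card ({d k} \<times> Z i))"
        unfolding \<Phi>_def by (rule card_UN_le) simp
      also have "\<dots> = K_R * ((m - j) * u)" by (simp add: card_cartesian_product *)
      finally show ?thesis .
    qed
    have "Max ((\<lambda>i. card (fronthaul D i)) ` {..<K_T}) \<le> K_R * ((m - j) * u)"
      using K_T card by (subst Max_le_iff) (auto simp: D_def lessThan_empty_iff)
    then have "real (Max ((\<lambda>i. card (fronthaul D i)) ` {..<K_T})) \<le> real K_R * (real (m - j) * real u)"
      by (metis of_nat_le_iff of_nat_mult)
    then have "fronthaul_ndt K_T r F D \<le> real K_R * (real (m - j) * real u) / (real F * r)"
      using False r by (auto simp: fronthaul_ndt_def intro: divide_right_mono)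
    also have "\<dots> = real K_R * real (m - j) / (real K_T * r)"
      using u K_T False by (simp add: F_def field_simps)
    finally show ?thesis .
  qed (simp add: fronthaul_ndt_def)
  ultimately show ?thesis by blast
qed

text \<open>The placement is fixed first, then a delivery is chosen for each request and channel.
  Since the bound is uniform in both, it survives the two suprema. The cache constraint is where
  \<open>j \<le> \<mu> K_T\<close> enters: each node stores \<open>j * u\<close> of the
  \<open>K_T * u\<close> packets of a file.\<close>

lemma delta_bar_le:
  fixes K_T K_R n_T N j m :: nat and r \<mu> :: real
  assumes K_T: "K_T \<ge> 1" and K_R: "K_R \<ge> 1" and n_T: "n_T \<ge> 1"
    and m: "1 \<le> m" "m \<le> K_T" and j: "j \<le> K_T" "real j \<le> \<mu> * real K_T"
    and r: "r \<ge> 0" "r = 0 \<Longrightarrow> m \<le> j"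
  shows "delta_bar K_T K_R n_T N \<mu> r
    \<le> ennreal (real K_R * real (m - j) / (real K_T * r) + real K_R / real (min (m * n_T) K_R))"
proof -
  define u where "u = min (m * n_T) K_R"
  define F where "F = K_T * u"
  define C where "C = (\<lambda>i n. {n :: nat} \<times> {f. f < F \<and> (i + f) mod K_T < j})"
  have u: "1 \<le> u" using m n_T K_R by (auto simp: u_def)
  have "\<exists>D. valid_delivery K_T K_R n_T N r F C d h D \<and>
      fronthaul_ndt K_T r F D \<le> real K_R * real (m - j) / (real K_T * r) \<and>
      edge_ndt F D = real K_R / real u"
    if "d \<in> requests K_R N" "h \<in> channels K_T K_R n_T" for d h
    unfolding u_def F_def C_def by (rule ex_valid_delivery) (use assms that in auto)
  then obtain \<pi> where \<pi>: "\<And>d h. d \<in> requests K_R N \<Longrightarrow> h \<in> channels K_T K_R n_T \<Longrightarrow>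
      valid_delivery K_T K_R n_T N r F C d h (\<pi> d h) \<and>
      fronthaul_ndt K_T r F (\<pi> d h) \<le> real K_R * real (m - j) / (real K_T * r) \<and>
      edge_ndt F (\<pi> d h) = real K_R / real u"
    by metis
  have "valid_caching K_T N \<mu> F C"
    unfolding valid_caching_def
  proof (intro allI impI conjI)
    fix i n
    show "C i n \<subseteq> file_packets F n" by (auto simp: C_def file_packets_def)
    have "real (card (C i n)) = real j * real u"
      using card_residues[OF j(1), of u i] by (simp add: C_def card_cartesian_product F_def)
    also have "\<dots> \<le> \<mu> * real K_T * real u" using j(2) by (intro mult_right_mono) auto
    finally show "real (card (C i n)) \<le> \<mu> * real F" by (simp add: F_def)
  qed
  moreover have "F \<ge> 1" using u K_T by (simp add: F_def)
  ultimately have "valid_policy K_T K_R n_T N \<mu> r F C \<pi>"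
    using \<pi> by (simp add: valid_policy_def)
  then have "delta_bar K_T K_R n_T N \<mu> r \<le> policy_ndt K_T K_R n_T N r F \<pi>"
    unfolding delta_bar_def by (intro Inf_lower) auto
  also have "\<dots> \<le> ennreal (real K_R * real (m - j) / (real K_T * r) + real K_R / real u)"
    unfolding policy_ndt_def
    by (intro SUP_least ennreal_leI add_mono) (use \<pi> in auto)
  finally show ?thesis by (simp add: u_def)
qed

section \<open>The multiplicity\<close>

lemma m_max_bounds:
  assumes "K_T \<ge> 1" "K_R \<ge> 1" "n_T \<ge> 1"
  shows "1 \<le> m_max K_T K_R n_T" "m_max K_T K_R n_T \<le> K_T"
proof -
  have "0 < real K_R / real n_T" using assms by simp
  then have "0 < \<lceil>real K_R / real n_T\<rceil>" by simp
  then show "1 \<le> m_max K_T K_R n_T" using assms unfolding m_max_def by linarith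
qed (simp add: m_max_def)

text \<open>Below the threshold the square root is smaller than \<open>m_max\<close>. An integer
  above \<open>m_max\<close> would then be farther from it than \<open>m_max\<close> itself, so
  rounding cannot overshoot, however ties are broken.\<close>

lemma m_rate_bounds:
  assumes "K_T \<ge> 1" "K_R \<ge> 1" "n_T \<ge> 1" "r \<ge> 0" "nearest_pos_rule rnd"
  shows "1 \<le> m_rate rnd K_T K_R n_T r" "m_rate rnd K_T K_R n_T r \<le> m_max K_T K_R n_T"
proof -
  let ?x = "sqrt (real K_T * r / real n_T)" and ?M = "m_max K_T K_R n_T"
  note M = m_max_bounds[OF assms(1-3)]
  have x: "?x \<ge> 0" using assms by simp
  have rnd: "1 \<le> rnd ?x" "\<bar>?x - real (rnd ?x)\<bar> \<le> \<bar>?x - real ?M\<bar>"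
    using assms(5) x M(1) unfolding nearest_pos_rule_def by auto
  show "1 \<le> m_rate rnd K_T K_R n_T r" using rnd M by (simp add: m_rate_def)
  have "rnd ?x \<le> ?M" if "r < r_th K_T K_R n_T"
  proof -
    have "real K_T * r / real n_T < (real ?M)\<^sup>2"
      using that assms by (simp add: r_th_def field_simps)
    then have "?x < real ?M" by (intro real_less_lsqrt) auto
    with rnd(2) show ?thesis by linarith
  qed
  then show "m_rate rnd K_T K_R n_T r \<le> ?M" by (simp add: m_rate_def)
qed

section \<open>Pointwise bound and passage to the envelopes\<close>

lemma lower_convex_envelope_mono:
  assumes "\<And>y. y \<in> S \<Longrightarrow> f y \<le> g y"
  shows "lower_convex_envelope S f x \<le> lower_convex_envelope S g x"
  unfolding lower_convex_envelope_def
  by (rule SUP_subset_mono) (use assms order_trans in blast)+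

lemma delta_bar_le_delta_F_delta_E:
  assumes pos: "K_T \<ge> 1" "K_R \<ge> 1" "n_T \<ge> 1" and r: "r \<ge> 0"
    and \<mu>: "0 \<le> \<mu>" "\<mu> \<le> 1" and rnd: "nearest_pos_rule rnd"
  shows "delta_bar K_T K_R n_T N \<mu> r
    \<le> delta_F rnd K_T K_R n_T \<mu> r + delta_E rnd K_T K_R n_T \<mu> r"
proof -
  define j where "j = nat \<lfloor>\<mu> * real K_T\<rfloor>"
  define m where "m = m_mult rnd K_T K_R n_T \<mu> r"
  have "0 \<le> \<mu> * real K_T" using \<mu> by simp
  then have j: "\<lfloor>\<mu> * real K_T\<rfloor> = int j" "real j \<le> \<mu> * real K_T"
    by (simp_all add: j_def)
  have "\<mu> * real K_T \<le> 1 * real K_T" using \<mu> by (intro mult_right_mono) auto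
  with j(2) have jK: "j \<le> K_T" by simp
  \<comment> \<open>In the middle case of \<open>m_mult\<close> the value is \<open>j\<close>. It is
    positive because the integer \<open>m_rate\<close> is at least 1 and at most
    \<open>\<mu> K_T\<close>, hence at most the floor \<open>j\<close>.\<close>
  have m: "1 \<le> m" "m \<le> K_T"
    using m_max_bounds[OF pos] m_rate_bounds[OF pos r rnd] jK
      le_nat_floor[of "m_rate rnd K_T K_R n_T r" "\<mu> * real K_T"]
    by (auto simp: m_def m_mult_def not_less simp flip: j_def split: if_splits)
  have F: "delta_F rnd K_T K_R n_T \<mu> r = ennreal (real K_R * real (m - j)) / ennreal (real K_T * r)"
  proof -
    have "max (real m - real_of_int \<lfloor>\<mu> * real K_T\<rfloor>) 0 = real (m - j)"
      by (simp add: j(1) of_nat_diff_if max_def)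
    then show ?thesis by (simp add: delta_F_def m_def)
  qed
  have E: "delta_E rnd K_T K_R n_T \<mu> r = ennreal (real K_R / real (min (m * n_T) K_R))"
    by (simp add: delta_E_def m_def)
  \<comment> \<open>Without fronthaul, either \<open>m > j\<close> and \<open>delta_F\<close> is
    infinite, or \<open>m \<le> j\<close> and caching alone suffices. In the latter case the real
    quotient in \<open>delta_bar_le\<close> is zero, so only the edge term is left.\<close>
  consider "r > 0" | "r = 0" "m \<le> j" | "r = 0" "m > j" using r by linarith
  then show ?thesis
  proof cases
    case 3
    then have "delta_F rnd K_T K_R n_T \<mu> r = top_class.top"
      unfolding F using pos by simp
    then show ?thesis by simp
  next
    case 1
    have "delta_bar K_T K_R n_T N \<mu> r
      \<le> ennreal (real K_R * real (m - j) / (real K_T * r) + real K_R / real (min (m * n_T) K_R))"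
      by (rule delta_bar_le) (use pos m jK j 1 in auto)
    also have "\<dots> = delta_F rnd K_T K_R n_T \<mu> r + delta_E rnd K_T K_R n_T \<mu> r"
      unfolding F E using 1 pos by (simp add: ennreal_plus divide_ennreal)
    finally show ?thesis .
  next
    case 2
    have "delta_bar K_T K_R n_T N \<mu> r
      \<le> ennreal (real K_R * real (m - j) / (real K_T * r) + real K_R / real (min (m * n_T) K_R))"
      by (rule delta_bar_le) (use pos m jK j 2 in auto)
    also have "\<dots> \<le> delta_F rnd K_T K_R n_T \<mu> r + delta_E rnd K_T K_R n_T \<mu> r"
      unfolding E using 2 by simp
    finally show ?thesis .
  qed
qed

theorem proposition3:
  fixes K_T K_R n_T N :: nat and \<mu> r :: real and rnd :: "real \<Rightarrow> nat"
  assumes "K_T \<ge> 1" and "K_R \<ge> 1" and "n_T \<ge> 1" and "N \<ge> K_R"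
    and "r \<ge> 0" and "0 \<le> \<mu>" and "\<mu> \<le> 1"
    and "nearest_pos_rule rnd"
  shows "delta_star K_T K_R n_T N \<mu> r \<le> delta_ach rnd K_T K_R n_T \<mu> r"
  unfolding delta_star_def delta_ach_def
  by (intro lower_convex_envelope_mono delta_bar_le_delta_F_delta_E) (use assms in auto)

end
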